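(* Let $\Omega\subset AX_2$ be the set of affine lattices containing a horizontal vector $(x,0)$ with $0<x\le1$. Then $\Omega$ is a transversal for the space $AX_2$ of affine lattices under the horocycle flow $(h_u)_{u\in\mathbb{R}}$. It is parameterized as the union of $$\left\{\left(h_sp_{a,b},\begin{pmatrix}\alpha\\0\end{pmatrix}\right):a\in(0,1],\ b\in(1-a,1],\ s\in[0,(ab)^{-1}),\ \alpha\in(0,1]\right\}$$ and $$\left\{\left(h_sg_{\log(a)},\begin{pmatrix}\alpha\\0\end{pmatrix}\right):a\in(0,1],\ s\in(0,a^2],\ \alpha\in(0,1]\right\}.$$ For a point of the first set with coordinates $(a,b,s,\alpha)$, the return time $$R(a,b,s,\alpha)=\min\{u>0:h_u(h_sp_{a,b}\mathbb{Z}^2+(\alpha,0)^T)\in\Omega\}$$ is given as follows, where $j=\left\lfloor\frac{1+a-\alpha}{b}\right\rfloor$. If $\alpha>a$, then $$R(a,b,s,\alpha)=\begin{cases}\dfrac{sa}{\alpha-a}, & \text{if } s<\dfrac{\alpha-a}{ab\alpha},\\[8pt] \dfrac{j(a^{-1}-sb)+sa}{\alpha-a+jb}, & \text{if } s>\dfrac{\alpha-a}{ab\alpha}.\end{cases}$$ If $\alpha\le a$, then $$R(a,b,s,\alpha)=\begin{cases}\dfrac{a^{-1}-sb}{b+\alpha}, & \text{if } b+\alpha<1,\\[8pt] \dfrac{j(a^{-1}-sb)+sa}{\alpha-a+jb}, & \text{if } b+\alpha>1.\end{cases}$$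
   Context: An affine lattice is a set $(g,v):=g\mathbb{Z}^2+v\subset\mathbb{R}^2$ with $g\in SL_2(\mathbb{R})$, $v\in\mathbb{R}^2$. The space of affine lattices is $AX_2=(SL_2(\mathbb{R})\ltimes\mathbb{R}^2)/(SL_2(\mathbb{Z})\ltimes\mathbb{Z}^2)$, with $SL_2(\mathbb{R})$ acting by $A\cdot(g\mathbb{Z}^2+v)=Ag\mathbb{Z}^2+Av$. Notation: $$h_u=\begin{pmatrix}1&0\\-u&1\end{pmatrix},\qquad p_{a,b}=\begin{pmatrix}a&b\\0&a^{-1}\end{pmatrix},\qquad g_t=\begin{pmatrix}e^t&0\\0&e^{-t}\end{pmatrix}.$$ The horocycle flow is the action of $(h_u)_{u\in\mathbb{R}}$. A transversal is a subset such that almost every orbit of the flow meets it in a non-empty, countable, discrete set of times. Equivalently, $R(a,b,s,\alpha)$ is the minimum of $\frac{(a^{-1}-sb)n-sam}{ma+nb+\alpha}$ over $m,n\in\mathbb{Z}$ subject to $0<ma+nb+\alpha\le1$ and $(a^{-1}-sb)n-sam>0$.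
   Formalization: Printed claim fails; mended: second set uses g_{-log a}; sa/(α-a) needs s>0; the formula with j is asserted only if row m=-1 dominates (a condition on a,b,α), while in those cases R is in general the infimum over k≥1 of the analogous expression for m=-k. *)

theory Defs
  imports "HOL-Analysis.Analysis"
begin

type_synonym plane = "real ^ 2"
type_synonym mat2 = "real ^ 2 ^ 2"

definition SL2R :: "mat2 set" where
  "SL2R = {g. det g = 1}"

definition Z2 :: "plane set" where
  "Z2 = {n. \<forall>i. n $ i \<in> \<int>}"

definition affine_lattice :: "mat2 \<Rightarrow> plane \<Rightarrow> plane set" where
  "affine_lattice g v = (\<lambda>n. g *v n + v) ` Z2"

text \<open>
  The space of affine lattices, as a set of subsets of the plane. The stabiliser of the standard
  lattice in the affine group is the integral affine group, so the points are exactly the cosets.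
\<close>

definition AX2 :: "plane set set" where
  "AX2 = {affine_lattice g v | g v. g \<in> SL2R}"

definition act :: "mat2 \<Rightarrow> plane set \<Rightarrow> plane set" where
  "act A L = (\<lambda>x. A *v x) ` L"

definition h_mat :: "real \<Rightarrow> mat2" where
  "h_mat u = vector [vector [1, 0], vector [- u, 1]]"

definition p_mat :: "real \<Rightarrow> real \<Rightarrow> mat2" where
  "p_mat a b = vector [vector [a, b], vector [0, inverse a]]"

definition g_mat :: "real \<Rightarrow> mat2" where
  "g_mat t = vector [vector [exp t, 0], vector [0, exp (- t)]]"

text \<open>
  Haar measure on \<open>SL\<^sub>2(\<real>)\<close> (up to a constant) is the cone measure: a set \<open>B\<close> gets the Lebesgue
  measure of the set of all \<open>r A\<close> with \<open>0 < r \<le> 1\<close> and \<open>A \<in> B\<close>. It lives on the whole matrix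
  space but is concentrated on \<^const>\<open>SL2R\<close>.
\<close>

definition haar_SL2R :: "mat2 measure" where
  "haar_SL2R =
     distr (restrict_space lborel {A. 0 < det A \<and> det A \<le> 1}) borel
       (\<lambda>A. (1 / sqrt (det A)) *\<^sub>R A)"

text \<open>
  The affine group is unimodular and its Haar measure is the product of the Haar measure on the
  linear part with Lebesgue measure on the translation part.
\<close>

definition haar_ASL2R :: "(mat2 \<times> plane) measure" where
  "haar_ASL2R = haar_SL2R \<Otimes>\<^sub>M lborel"

text \<open>
  The invariant measure on \<^const>\<open>AX2\<close> is induced by Haar measure on the group. The integral affine
  group is countable, so a set of affine lattices is null iff its preimage in the group is.
\<close>

definition almost_every_affine_lattice :: "(plane set \<Rightarrow> bool) \<Rightarrow> bool" where
  "almost_every_affine_lattice P \<longleftrightarrow> (AE (A, v) in haar_ASL2R. P (affine_lattice A v))"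

definition hit_times :: "plane set set \<Rightarrow> plane set \<Rightarrow> real set" where
  "hit_times T L = {u. act (h_mat u) L \<in> T}"

definition horocycle_transversal :: "plane set set \<Rightarrow> bool" where
  "horocycle_transversal T \<longleftrightarrow>
     T \<subseteq> AX2 \<and>
     almost_every_affine_lattice (\<lambda>L.
       hit_times T L \<noteq> {} \<and> countable (hit_times T L) \<and> discrete (hit_times T L))"

definition Omega :: "plane set set" where
  "Omega = {L \<in> AX2. \<exists>x. 0 < x \<and> x \<le> 1 \<and> vector [x, 0] \<in> L}"

definition return_times :: "plane set \<Rightarrow> real set" where
  "return_times L = {u \<in> hit_times Omega L. 0 < u}"

definition params1 :: "(real \<times> real \<times> real \<times> real) set" where
  "params1 = {(a, b, s, \<alpha>). 0 < a \<and> a \<le> 1 \<and> 1 - a < b \<and> b \<le> 1 \<and>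
                            0 \<le> s \<and> s < inverse (a * b) \<and> 0 < \<alpha> \<and> \<alpha> \<le> 1}"

definition params2 :: "(real \<times> real \<times> real) set" where
  "params2 = {(a, s, \<alpha>). 0 < a \<and> a \<le> 1 \<and> 0 < s \<and> s \<le> a\<^sup>2 \<and> 0 < \<alpha> \<and> \<alpha> \<le> 1}"

definition point1 :: "real \<Rightarrow> real \<Rightarrow> real \<Rightarrow> real \<Rightarrow> plane set" where
  "point1 a b s \<alpha> = affine_lattice (h_mat s ** p_mat a b) (vector [\<alpha>, 0])"

text \<open>
  The vertical lattices that never meet the transversal for \<^emph>\<open>linear\<close> lattices are those containing
  a vertical vector \<open>(0, a)\<close> with \<open>a < 1\<close>. They are the \<open>h\<^sub>s diag(1/a, a) \<int>\<^sup>2\<close>, periodic in \<open>s\<close> with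
  period \<open>a\<^sup>2\<close>. This is why the diagonal matrix is \<open>g_mat\<close> at \<open>-log a\<close>; with \<open>log a\<close>
  instead the two families would not cover \<open>(diag(2, 1/2) \<int>\<^sup>2) + (1, 0)\<close>.
\<close>

definition point2 :: "real \<Rightarrow> real \<Rightarrow> real \<Rightarrow> plane set" where
  "point2 a s \<alpha> = affine_lattice (h_mat s ** g_mat (- ln a)) (vector [\<alpha>, 0])"

definition return_time :: "real \<Rightarrow> real \<Rightarrow> real \<Rightarrow> real \<Rightarrow> real" where
  "return_time a b s \<alpha> = (LEAST u. u \<in> return_times (point1 a b s \<alpha>))"

text \<open>
  For \<open>k \<ge> 1\<close>, \<open>row_index a b \<alpha> k\<close> is the largest \<open>n\<close> for which the point of \<open>point1 a b s \<alpha>\<close> with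
  integer coordinates \<open>(-k, n)\<close> has abscissa at most \<open>1\<close>; \<open>row_abscissa\<close> is that abscissa and
  \<open>row_slope\<close> the slope of that point. The case \<open>k = 1\<close> gives the number \<open>j\<close> and the value
  \<open>(j(1/a - sb) + sa) / (\<alpha> - a + jb)\<close>.

  The point with \<open>k = 1\<close> need not have the least slope. For \<open>(a, b, s, \<alpha>) = (1/2, 19/20, 21/10, 9/10)\<close>
  we have \<open>\<alpha> > a\<close>, \<open>s > (\<alpha> - a)/(ab\<alpha>)\<close> and \<open>j = 0\<close>; the row \<open>k = 1\<close> gives \<open>21/8\<close>, but \<open>(-2, 1)\<close> has
  abscissa \<open>17/20\<close> and slope \<open>421/170 < 21/8\<close>. For \<open>(1, 4/5, 6/5, 1/2)\<close> we have \<open>\<alpha> \<le> a\<close>,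
  \<open>b + \<alpha> > 1\<close> and \<open>j = 1\<close>; the row \<open>k = 1\<close> gives \<open>62/15\<close>, but \<open>(-2, 3)\<close> has abscissa \<open>9/10\<close> and
  slope \<open>14/5\<close>. Both failures persist under small perturbations.
\<close>

definition row_index :: "real \<Rightarrow> real \<Rightarrow> real \<Rightarrow> nat \<Rightarrow> int" where
  "row_index a b \<alpha> k = \<lfloor>(1 + real k * a - \<alpha>) / b\<rfloor>"

definition row_abscissa :: "real \<Rightarrow> real \<Rightarrow> real \<Rightarrow> nat \<Rightarrow> real" where
  "row_abscissa a b \<alpha> k = \<alpha> - real k * a + of_int (row_index a b \<alpha> k) * b"

definition row_slope :: "real \<Rightarrow> real \<Rightarrow> real \<Rightarrow> real \<Rightarrow> nat \<Rightarrow> real" where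
  "row_slope a b s \<alpha> k =
     (of_int (row_index a b \<alpha> k) * (inverse a - s * b) + real k * s * a) / row_abscissa a b \<alpha> k"

text \<open>
  A condition on \<open>(a, b, \<alpha>)\<close> under which the row \<open>k = 1\<close> gives the least slope for every admissible
  \<open>s\<close>. If it fails then some other row has smaller slope for all \<open>s\<close> close to \<open>1/(ab)\<close>.
  It holds for instance whenever \<open>row_abscissa a b \<alpha> 1 \<ge> 1/2\<close>.
\<close>

definition first_row_dominant :: "real \<Rightarrow> real \<Rightarrow> real \<Rightarrow> bool" where
  "first_row_dominant a b \<alpha> \<longleftrightarrow>
     (\<forall>k\<ge>2. row_abscissa a b \<alpha> k \<le> real k * row_abscissa a b \<alpha> 1)"

end

theory Submission
  imports Defs
begin

text \<open>
  The shear \<open>h\<^sub>u\<close> keeps the abscissa of a point and makes a point \<open>(x, y)\<close> horizontal exactly when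
  \<open>u = y / x\<close>. Hence the orbit of an affine lattice \<open>L\<close> meets \<^const>\<open>Omega\<close> exactly at the slopes of
  the points of \<open>L\<close> in the vertical strip \<open>0 < x \<le> 1\<close> (\<open>hit_times_Omega\<close>), and everything below is
  about these slopes.

  \<^emph>\<open>Transversality.\<close> A bound on the slope bounds the part of the strip, so only finitely many points
  of \<open>L\<close> qualify, and the hitting times are discrete and countable for every \<open>L\<close>. They exist as soon
  as the linear part of \<open>L\<close> has a vector with abscissa in \<open>(0, 1]\<close>, by which any point can be
  translated into the strip. By Dirichlet's approximation theorem such a vector can only be missing
  if the abscissas of the two basis vectors satisfy an integer relation, and matrices with such a
  relation lie in countably many hyperplanes (\<open>horocycle_transversal_Omega\<close>).

  \<^emph>\<open>Parametrization.\<close> A lattice in \<^const>\<open>Omega\<close> may be translated so that its offset is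
  \<open>(\<alpha>, 0)\<close>; a normal form of its linear part remains to be found. If the linear part has vectors in
  the strip, choose one whose slope \<open>- s\<close> is the largest slope \<open>\<le> 0\<close>, take it primitive and complete
  it to a basis by Bezout, with the second abscissa \<open>b\<close> in \<open>(1 - a, 1]\<close>. The second basis vector also
  lies in the strip and has slope \<open>1 / (ab) - s > - s\<close>, which is positive by maximality; this is
  the bound \<open>s < 1 / (ab)\<close> (\<open>shear_normal_form\<close>). If there is no such vector, Dirichlet's theorem
  gives a vertical vector, and the lattice is a sheared diagonal one (\<open>diagonal_normal_form\<close>).

  \<^emph>\<open>Return times.\<close> The return time is the least positive slope in the strip. The point of
  \<^const>\<open>point1\<close> with integer coordinates \<open>(m, n)\<close> and abscissa \<open>x\<close> has slope
  \<open>1 / (ab) - s + (- m a - \<alpha> (1 - s a b)) / (a b x)\<close> (\<open>slope_eq\<close>), so among the points with the same \<open>m\<close> the sign of the last numerator decides whether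
  the smallest or the largest abscissa is best. The inequality \<open>a + b > 1\<close> excludes \<open>m > 0\<close>, and
  leaves \<open>m = 0\<close> only if \<open>b + \<alpha> \<le> 1\<close>. On the remaining rows \<open>m = - k\<close>, \<open>k \<ge> 1\<close>, the numerator is
  \<open>\<ge> 0\<close> in the two cases with an infimum, so that the largest abscissa wins: this is
  \<^const>\<open>row_slope\<close>. In the two other cases one point beats all others by a direct comparison.
\<close>

section \<open>Affine lattices in coordinates\<close>

lemma mem_affine_lattice:
  "w \<in> affine_lattice g v \<longleftrightarrow>
     (\<exists>(m :: int) (n :: int). w $ 1 = g $ 1 $ 1 * m + g $ 1 $ 2 * n + v $ 1
                 \<and> w $ 2 = g $ 2 $ 1 * m + g $ 2 $ 2 * n + v $ 2)"
proof
  assume "w \<in> affine_lattice g v"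
  then obtain z where z: "z \<in> Z2" "w = g *v z + v"
    by (auto simp: affine_lattice_def)
  obtain m n where "z $ 1 = of_int m" "z $ 2 = of_int n"
    using z(1) unfolding Z2_def by (metis (mono_tags, lifting) Ints_cases mem_Collect_eq)
  with z(2) show "\<exists>(m :: int) (n :: int). w $ 1 = g $ 1 $ 1 * m + g $ 1 $ 2 * n + v $ 1
                 \<and> w $ 2 = g $ 2 $ 1 * m + g $ 2 $ 2 * n + v $ 2"
    by (intro exI[of _ m] exI[of _ n]) (simp add: matrix_vector_mult_def sum_2)
next
  assume "\<exists>(m :: int) (n :: int). w $ 1 = g $ 1 $ 1 * m + g $ 1 $ 2 * n + v $ 1
                 \<and> w $ 2 = g $ 2 $ 1 * m + g $ 2 $ 2 * n + v $ 2"
  then obtain m n :: int where mn: "w $ 1 = g $ 1 $ 1 * m + g $ 1 $ 2 * n + v $ 1"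
    "w $ 2 = g $ 2 $ 1 * m + g $ 2 $ 2 * n + v $ 2" by blast
  have "w = g *v vector [of_int m, of_int n] + v"
    using mn by (simp add: vec_eq_iff forall_2 matrix_vector_mult_def sum_2)
  moreover have "vector [of_int m, of_int n] \<in> Z2"
    by (simp add: Z2_def forall_2)
  ultimately show "w \<in> affine_lattice g v"
    by (auto simp: affine_lattice_def)
qed

lemma affine_lattice_change_basis:
  fixes m n p q :: int
  assumes "m * q - p * n = 1"
    and "\<And>i. g' $ i $ 1 = g $ i $ 1 * m + g $ i $ 2 * n"
    and "\<And>i. g' $ i $ 2 = g $ i $ 1 * p + g $ i $ 2 * q"
  shows "affine_lattice g' v = affine_lattice g v"
proof (rule set_eqI)
  fix w
  have d: "real_of_int m * real_of_int q - real_of_int p * real_of_int n = 1"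
    using assms(1) by (metis of_int_1 of_int_diff of_int_mult)
  show "w \<in> affine_lattice g' v \<longleftrightarrow> w \<in> affine_lattice g v"
  proof
    assume "w \<in> affine_lattice g' v"
    then obtain k l :: int where "\<And>i. i = 1 \<or> i = 2 \<Longrightarrow>
        w $ i = g' $ i $ 1 * k + g' $ i $ 2 * l + v $ i"
      unfolding mem_affine_lattice by blast
    then show "w \<in> affine_lattice g v"
      unfolding mem_affine_lattice
      by (intro exI[of _ "m * k + p * l"] exI[of _ "n * k + q * l"])
        (simp add: assms(2,3) algebra_simps)
  next
    assume "w \<in> affine_lattice g v"
    then obtain k l :: int where "\<And>i. i = 1 \<or> i = 2 \<Longrightarrow>
        w $ i = g $ i $ 1 * k + g $ i $ 2 * l + v $ i"
      unfolding mem_affine_lattice by blast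
    moreover have "x * k + y * l = (x * m + y * n) * (q * k - p * l)
        + (x * p + y * q) * (m * l - n * k)" for x y :: real
      unfolding of_int_diff of_int_mult using d by algebra
    ultimately show "w \<in> affine_lattice g' v"
      unfolding mem_affine_lattice
      by (intro exI[of _ "q * k - p * l"] exI[of _ "m * l - n * k"])
        (simp add: assms(2,3))
  qed
qed

lemma affine_lattice_recentre:
  assumes "w \<in> affine_lattice g v"
  shows "affine_lattice g w = affine_lattice g v"
proof -
  obtain k l :: int where kl: "w $ 1 = g $ 1 $ 1 * k + g $ 1 $ 2 * l + v $ 1"
      "w $ 2 = g $ 2 $ 1 * k + g $ 2 $ 2 * l + v $ 2"
    using assms unfolding mem_affine_lattice by blast
  have "x \<in> affine_lattice g w \<longleftrightarrow> x \<in> affine_lattice g v" for x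
  proof
    assume "x \<in> affine_lattice g w"
    then obtain m n :: int where "x $ 1 = g $ 1 $ 1 * m + g $ 1 $ 2 * n + w $ 1"
      "x $ 2 = g $ 2 $ 1 * m + g $ 2 $ 2 * n + w $ 2"
      unfolding mem_affine_lattice by blast
    then show "x \<in> affine_lattice g v"
      unfolding mem_affine_lattice
      by (intro exI[of _ "m + k"] exI[of _ "n + l"]) (simp add: kl algebra_simps)
  next
    assume "x \<in> affine_lattice g v"
    then obtain m n :: int where "x $ 1 = g $ 1 $ 1 * m + g $ 1 $ 2 * n + v $ 1"
      "x $ 2 = g $ 2 $ 1 * m + g $ 2 $ 2 * n + v $ 2"
      unfolding mem_affine_lattice by blast
    then show "x \<in> affine_lattice g w"
      unfolding mem_affine_lattice
      by (intro exI[of _ "m - k"] exI[of _ "n - l"]) (simp add: kl algebra_simps)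
  qed
  then show ?thesis by blast
qed

lemma SL2R_iff: "g \<in> SL2R \<longleftrightarrow> g $ 1 $ 1 * g $ 2 $ 2 - g $ 1 $ 2 * g $ 2 $ 1 = 1"
  by (simp add: SL2R_def det_2)

lemma h_mat_entries [simp]:
  "h_mat u $ 1 $ 1 = 1" "h_mat u $ 1 $ 2 = 0" "h_mat u $ 2 $ 1 = - u" "h_mat u $ 2 $ 2 = 1"
  by (simp_all add: h_mat_def)

lemma h_mat_mult_entries [simp]:
  "(h_mat u ** g) $ 1 $ i = g $ 1 $ i" "(h_mat u ** g) $ 2 $ i = g $ 2 $ i - u * g $ 1 $ i"
  by (simp_all add: matrix_matrix_mult_def sum_2)

lemma p_mat_entries [simp]:
  "p_mat a b $ 1 $ 1 = a" "p_mat a b $ 1 $ 2 = b" "p_mat a b $ 2 $ 1 = 0"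
  "p_mat a b $ 2 $ 2 = inverse a"
  by (simp_all add: p_mat_def)

lemma g_mat_ln_entries [simp]:
  assumes "0 < a"
  shows "g_mat (- ln a) $ 1 $ 1 = inverse a" "g_mat (- ln a) $ 1 $ 2 = 0"
    "g_mat (- ln a) $ 2 $ 1 = 0" "g_mat (- ln a) $ 2 $ 2 = a"
  using assms by (simp_all add: g_mat_def exp_minus)

lemma h_mat_mult_SL2R: "g \<in> SL2R \<Longrightarrow> h_mat u ** g \<in> SL2R"
  by (simp add: SL2R_iff algebra_simps)

lemma act_affine_lattice: "act A (affine_lattice g v) = affine_lattice (A ** g) (A *v v)"
  by (simp add: act_def affine_lattice_def image_image matrix_vector_right_distrib
      matrix_vector_mul_assoc)

lemma act_h_mat_AX2:
  assumes "L \<in> AX2"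
  shows "act (h_mat u) L \<in> AX2"
  using assms by (fastforce simp: AX2_def act_affine_lattice intro: h_mat_mult_SL2R)

section \<open>Hitting times are slopes\<close>

lemma hit_times_Omega:
  assumes "L \<in> AX2"
  shows "hit_times Omega L = {u. \<exists>w \<in> L. 0 < w $ 1 \<and> w $ 1 \<le> 1 \<and> w $ 2 = u * w $ 1}"
proof -
  have "(\<exists>x>0. x \<le> 1 \<and> vector [x, 0] \<in> act (h_mat u) L) \<longleftrightarrow>
      (\<exists>w \<in> L. 0 < w $ 1 \<and> w $ 1 \<le> 1 \<and> w $ 2 = u * w $ 1)" for u
    by (auto simp: act_def vec_eq_iff forall_2 matrix_vector_mult_def sum_2 image_iff
        intro: bexI[rotated])
  then show ?thesis
    using act_h_mat_AX2[OF assms] by (auto simp: hit_times_def Omega_def)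
qed

text \<open>
  Inverting \<open>g\<close> expresses the integer coordinates of a point by its coordinates in the plane, so a
  bounded part of the plane contains only finitely many lattice points.
\<close>
lemma finite_strip_points_of_bounded_height:
  assumes "L \<in> AX2"
  shows "finite {w \<in> L. 0 < w $ 1 \<and> w $ 1 \<le> 1 \<and> \<bar>w $ 2\<bar> \<le> K}"
proof -
  obtain g v where L: "L = affine_lattice g v" and g: "g \<in> SL2R"
    using assms by (auto simp: AX2_def)
  define P where "P m n = (vector [g $ 1 $ 1 * of_int m + g $ 1 $ 2 * of_int n + v $ 1,
      g $ 2 $ 1 * of_int m + g $ 2 $ 2 * of_int n + v $ 2] :: plane)" for m n :: int
  define B where "B = \<lceil>(\<Sum>i\<in>UNIV. \<Sum>j\<in>UNIV. \<bar>g $ i $ j\<bar>) * (1 + \<bar>K\<bar> + \<bar>v $ 1\<bar> + \<bar>v $ 2\<bar>)\<rceil>"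
  have "{w \<in> L. 0 < w $ 1 \<and> w $ 1 \<le> 1 \<and> \<bar>w $ 2\<bar> \<le> K} \<subseteq>
      (\<lambda>(m, n). P m n) ` ({- B..B} \<times> {- B..B})"
  proof
    fix w assume w: "w \<in> {w \<in> L. 0 < w $ 1 \<and> w $ 1 \<le> 1 \<and> \<bar>w $ 2\<bar> \<le> K}"
    then obtain m n :: int where mn: "w $ 1 = g $ 1 $ 1 * m + g $ 1 $ 2 * n + v $ 1"
      "w $ 2 = g $ 2 $ 1 * m + g $ 2 $ 2 * n + v $ 2"
      unfolding L by (auto simp: mem_affine_lattice)
    have wP: "w = P m n"
      by (simp add: P_def vec_eq_iff forall_2 mn)
    define C where "C = 1 + \<bar>K\<bar> + \<bar>v $ 1\<bar> + \<bar>v $ 2\<bar>"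
    have c: "\<bar>w $ 1 - v $ 1\<bar> \<le> C" "\<bar>w $ 2 - v $ 2\<bar> \<le> C"
      using w by (auto simp: C_def)
    have bound: "\<bar>s * (w $ 1 - v $ 1)\<bar> \<le> \<bar>s\<bar> * C" "\<bar>s * (w $ 2 - v $ 2)\<bar> \<le> \<bar>s\<bar> * C" for s
      using c by (simp_all add: abs_mult mult_left_mono)
    have C0: "0 \<le> \<bar>s\<bar> * C" for s by (simp add: C_def)
    have det: "g $ 1 $ 1 * g $ 2 $ 2 - g $ 1 $ 2 * g $ 2 $ 1 = 1"
      using g by (simp add: SL2R_iff)
    have m: "m = g $ 2 $ 2 * (w $ 1 - v $ 1) - g $ 1 $ 2 * (w $ 2 - v $ 2)"
      unfolding mn using det by algebra
    have n: "n = g $ 1 $ 1 * (w $ 2 - v $ 2) - g $ 2 $ 1 * (w $ 1 - v $ 1)"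
      unfolding mn using det by algebra
    have B: "\<bar>g $ 1 $ 1\<bar> * C + \<bar>g $ 1 $ 2\<bar> * C + \<bar>g $ 2 $ 1\<bar> * C + \<bar>g $ 2 $ 2\<bar> * C \<le> of_int B"
      unfolding B_def C_def by (simp add: sum_2 algebra_simps)
    have "\<bar>real_of_int m\<bar> \<le> of_int B"
      using B bound[of "g $ 2 $ 2"] bound[of "g $ 1 $ 2"] C0[of "g $ 1 $ 1"] C0[of "g $ 2 $ 1"]
      unfolding m by linarith
    moreover have "\<bar>real_of_int n\<bar> \<le> of_int B"
      using B bound[of "g $ 1 $ 1"] bound[of "g $ 2 $ 1"] C0[of "g $ 2 $ 2"] C0[of "g $ 1 $ 2"]
      unfolding n by linarith
    ultimately have "m \<in> {- B..B}" "n \<in> {- B..B}" by auto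
    then show "w \<in> (\<lambda>(m, n). P m n) ` ({- B..B} \<times> {- B..B})"
      using wP by auto
  qed
  then show ?thesis by (rule finite_subset) simp
qed

lemma finite_hit_times_bounded:
  assumes "L \<in> AX2"
  shows "finite {u \<in> hit_times Omega L. \<bar>u\<bar> \<le> K}"
proof (rule finite_subset)
  show "{u \<in> hit_times Omega L. \<bar>u\<bar> \<le> K} \<subseteq>
      (\<lambda>w. w $ 2 / w $ 1) ` {w \<in> L. 0 < w $ 1 \<and> w $ 1 \<le> 1 \<and> \<bar>w $ 2\<bar> \<le> K}"
  proof
    fix u assume "u \<in> {u \<in> hit_times Omega L. \<bar>u\<bar> \<le> K}"
    then obtain w where w: "w \<in> L" "0 < w $ 1" "w $ 1 \<le> 1" "w $ 2 = u * w $ 1" and u: "\<bar>u\<bar> \<le> K"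
      by (auto simp: hit_times_Omega[OF assms])
    have "\<bar>w $ 2\<bar> \<le> \<bar>u\<bar>"
      using w by (simp add: abs_mult mult_left_le)
    then have "w \<in> {w \<in> L. 0 < w $ 1 \<and> w $ 1 \<le> 1 \<and> \<bar>w $ 2\<bar> \<le> K}"
      using w u by simp
    moreover have "u = w $ 2 / w $ 1" using w by simp
    ultimately show "u \<in> (\<lambda>w. w $ 2 / w $ 1) ` {w \<in> L. 0 < w $ 1 \<and> w $ 1 \<le> 1 \<and> \<bar>w $ 2\<bar> \<le> K}"
      by blast
  qed
qed (use finite_strip_points_of_bounded_height[OF assms] in simp)

lemma exists_int_translate:
  fixes x y c :: real
  assumes "0 < x"
  obtains k :: int where "c - x < y + k * x" "y + k * x \<le> c"
proof
  define k where "k = \<lfloor>(c - y) / x\<rfloor>"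
  have k: "of_int k \<le> (c - y) / x" "(c - y) / x < of_int k + 1"
    unfolding k_def by linarith+
  show "y + of_int k * x \<le> c" "c - x < y + of_int k * x"
    using k assms by (simp_all add: field_simps)
qed

text \<open>
  Let \<open>(x, y) = g(m, n)\<close> and let \<open>e'\<close> be the lattice vector \<open>g(-n, m)\<close>, so that the two span area
  \<open>d = m\<^sup>2 + n\<^sup>2 > 0\<close>. From \<open>v\<close> walk \<open>N\<close> steps along \<open>\<plusminus> e'\<close>, then return to the strip by a multiple of
  \<open>(x, y)\<close>, which is possible as \<open>x \<le> 1\<close>. The second walk does not change the signed area spanned
  with \<open>(x, y)\<close>, which grows like \<open>N d\<close>; inside the strip a large signed area means a large ordinate.
\<close>
lemma strip_meets_half_plane:
  fixes m n :: int
  assumes g: "g \<in> SL2R" and x: "0 < g $ 1 $ 1 * m + g $ 1 $ 2 * n" "g $ 1 $ 1 * m + g $ 1 $ 2 * n \<le> 1"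
    and e: "\<bar>e :: int\<bar> = 1"
  obtains w where "w \<in> affine_lattice g v" "0 < w $ 1" "w $ 1 \<le> 1" "0 < e * w $ 2"
proof -
  define x where "x = g $ 1 $ 1 * m + g $ 1 $ 2 * n"
  define y where "y = g $ 2 $ 1 * m + g $ 2 $ 2 * n"
  define d where "d = real_of_int (m * m + n * n)"
  have x01: "0 < x" "x \<le> 1" using assms by (simp_all add: x_def)
  have "m \<noteq> 0 \<or> n \<noteq> 0" using x by auto
  then have "0 < m * m + n * n" by (simp add: sum_squares_gt_zero_iff)
  then have "1 \<le> d" unfolding d_def by linarith
  define t where "t = x * v $ 2 - y * v $ 1"
  obtain N :: nat where N: "\<bar>y\<bar> + \<bar>t\<bar> < N" using reals_Archimedean2 by blast
  define x' where "x' = g $ 1 $ 1 * (- n) + g $ 1 $ 2 * m"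
  obtain k :: int where k: "1 - x < (e * int N * x' + v $ 1) + k * x"
      "(e * int N * x' + v $ 1) + k * x \<le> 1"
    using exists_int_translate[OF x01(1)] by blast
  define w :: plane where "w = vector
     [g $ 1 $ 1 * of_int (k * m - e * int N * n) + g $ 1 $ 2 * of_int (k * n + e * int N * m) + v $ 1,
      g $ 2 $ 1 * of_int (k * m - e * int N * n) + g $ 2 $ 2 * of_int (k * n + e * int N * m) + v $ 2]"
  have w1: "w $ 1 = (e * int N * x' + v $ 1) + k * x"
    by (simp add: w_def x_def x'_def algebra_simps)
  have w1': "0 < w $ 1" "w $ 1 \<le> 1" using k x01 unfolding w1 by auto
  have det: "g $ 1 $ 1 * g $ 2 $ 2 - g $ 1 $ 2 * g $ 2 $ 1 = 1"
    using g by (simp add: SL2R_iff)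
  \<comment> \<open>The signed area spanned by \<open>(x, y)\<close> and \<open>w\<close> is \<open>e N d\<close> plus that of \<open>(x, y)\<close> and \<open>v\<close>.\<close>
  have cross: "x * w $ 2 = y * w $ 1 + e * N * d + t"
  proof -
    have "x * w $ 2 - y * w $ 1 - t =
      (g $ 1 $ 1 * g $ 2 $ 2 - g $ 1 $ 2 * g $ 2 $ 1) * (e * N * d)"
      unfolding w_def x_def y_def t_def d_def by (simp add: algebra_simps)
    then show ?thesis using det by simp
  qed
  have ee: "real_of_int e = 1 \<or> real_of_int e = - 1" using e by auto
  have "\<bar>y * w $ 1\<bar> \<le> \<bar>y\<bar>" using w1' by (simp add: abs_mult mult_left_le)
  moreover have "real N * 1 \<le> N * d" using \<open>1 \<le> d\<close> by (intro mult_left_mono) auto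
  ultimately have "0 < e * (x * w $ 2)"
    unfolding cross using N ee by (auto simp: algebra_simps)
  then have "0 < x * (e * w $ 2)" by (simp add: algebra_simps)
  then have "0 < e * w $ 2" using x01 by (simp add: zero_less_mult_iff)
  moreover have "w \<in> affine_lattice g v"
    unfolding mem_affine_lattice
    by (intro exI[of _ "k * m - e * int N * n"] exI[of _ "k * n + e * int N * m"])
      (simp add: w_def)
  ultimately show ?thesis using that w1' by blast
qed

section \<open>The transversal property\<close>

text \<open>
  For \<open>q \<noteq> 0\<close>, approximate \<open>p / q\<close> by \<open>h / k\<close> with error below \<open>1 / (k N)\<close>, where \<open>N > \<bar>q\<bar>\<close>.
\<close>
lemma small_integer_combination:
  fixes p q :: real
  obtains m n :: int where "m \<noteq> 0 \<or> n \<noteq> 0" "\<bar>p * m + q * n\<bar> \<le> 1"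
proof (cases "q = 0")
  case True
  then show ?thesis using that[of 0 1] by simp
next
  case False
  obtain N :: nat where N: "\<bar>q\<bar> < N" using reals_Archimedean2 by blast
  then have "N > 0" by (cases N) auto
  obtain h k where hk: "0 < k" "\<bar>of_int k * (p / q) - of_int h\<bar> < 1 / N"
    using Dirichlet_approx[OF \<open>N > 0\<close>] by blast
  have "p * k + q * (- h) = q * (of_int k * (p / q) - of_int h)"
    using False by (simp add: field_simps)
  then have "\<bar>p * k + q * (- h)\<bar> = \<bar>q\<bar> * \<bar>of_int k * (p / q) - of_int h\<bar>"
    by (simp add: abs_mult)
  also have "\<dots> \<le> N * (1 / N)"
    using N hk(2) by (intro mult_mono) auto
  also have "\<dots> = 1" using \<open>N > 0\<close> by simp
  finally show ?thesis using that[of k "- h"] hk(1) by simp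
qed

lemma discrete_if_finite_bounded_parts:
  fixes S :: "real set"
  assumes "\<And>K. finite {u \<in> S. \<bar>u\<bar> \<le> K}"
  shows "discrete S"
  unfolding discrete_def
proof
  fix x assume x: "x \<in> S"
  define F where "F = {u \<in> S. \<bar>u\<bar> \<le> \<bar>x\<bar> + 1} - {x}"
  have "open (ball x 1 - F)"
    using assms by (intro open_Diff finite_imp_closed) (auto simp: F_def)
  moreover have "(ball x 1 - F) \<inter> S = {x}"
    using x by (auto simp: F_def dist_real_def)
  ultimately show "x isolated_in S"
    unfolding isolated_in_def using x by blast
qed

text \<open>
  The matrices whose first row satisfies a nontrivial integer relation. They contain all matrices
  whose lattice has no vector with abscissa in \<open>(0, 1]\<close>.
\<close>
definition row_relations :: "mat2 set" where
  "row_relations = (\<Union>(m, n) \<in> UNIV - {(0 :: int, 0 :: int)}. {A. A $ 1 $ 1 * m + A $ 1 $ 2 * n = 0})"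

lemma row_relations_null: "row_relations \<in> null_sets lborel"
  unfolding row_relations_def
proof (rule null_sets_UN', goal_cases)
  case 1
  then show ?case by (rule countableI_type)
next
  case (2 z)
  obtain m n where z: "z = (m, n)" by (cases z)
  define c :: mat2 where "c = axis 1 (vector [of_int m, of_int n])"
  have "c \<noteq> 0"
    using 2 by (auto simp: z c_def axis_eq_0_iff vec_eq_iff forall_2)
  then have "negligible {A. c \<bullet> A = 0}" by (simp add: negligible_hyperplane)
  moreover have "{A. c \<bullet> A = 0} = {A. A $ 1 $ 1 * m + A $ 1 $ 2 * n = 0}"
    by (simp add: c_def inner_axis' inner_vec_def[where 'a = real] sum_2 mult.commute)
  moreover have "{A. c \<bullet> A = 0} \<in> sets borel" by measurable
  ultimately show ?case
    by (simp add: z negligible_iff_null_sets null_sets_completion_iff)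
qed

text \<open>
  The relations are homogeneous, so rescaling a matrix to determinant 1 neither creates nor destroys
  them: the preimage under the rescaling is again contained in a Lebesgue null set. The complement
  of \<^const>\<open>SL2R\<close> has empty preimage.
\<close>
lemma exceptional_null_haar: "row_relations \<union> - SL2R \<in> null_sets haar_SL2R"
proof -
  define S where "S = {A :: mat2. 0 < det A \<and> det A \<le> 1}"
  define f where "f A = (1 / sqrt (det A)) *\<^sub>R A" for A :: mat2
  have det: "det \<in> borel_measurable (borel :: mat2 measure)"
    unfolding det_2[abs_def] by (intro borel_measurable_continuous_onI continuous_intros)
  have S: "S \<in> sets (lborel :: mat2 measure)"
    unfolding S_def using det by measurable
  have f: "f \<in> borel_measurable (restrict_space lborel S)"
    unfolding f_def by (intro measurable_restrict_space1) (use det in measurable)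
  have SL2R: "SL2R \<in> sets borel"
    unfolding SL2R_def using det by measurable
  have R: "row_relations \<in> sets borel"
    using row_relations_null by auto
  have "f A \<in> row_relations \<union> - SL2R \<longleftrightarrow> A \<in> row_relations" if "A \<in> S" for A
  proof -
    have pos: "0 < det A" using that by (simp add: S_def)
    have "(1 / sqrt (det A)) * (1 / sqrt (det A)) = 1 / det A"
      using pos by simp
    moreover have "det (c *\<^sub>R A) = (c * c) * det A" for c
      by (simp add: det_2 algebra_simps)
    ultimately have "det (f A) = (1 / det A) * det A" unfolding f_def by metis
    then have "f A \<in> SL2R" using pos by (simp add: SL2R_def)
    moreover have "f A $ 1 $ 1 * m + f A $ 1 $ 2 * n = 0 \<longleftrightarrow> A $ 1 $ 1 * m + A $ 1 $ 2 * n = 0"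
      for m n
      using pos by (simp add: f_def add_divide_distrib[symmetric] mult.commute)
    ultimately show ?thesis by (simp add: row_relations_def case_prod_beta)
  qed
  then have "f -` (row_relations \<union> - SL2R) \<inter> S = row_relations \<inter> S"
    by auto
  moreover have "row_relations \<inter> S \<in> null_sets lborel"
    using row_relations_null S by (rule null_set_Int2)
  ultimately have "row_relations \<union> - SL2R \<in> null_sets (distr (restrict_space lborel S) borel f)"
    using R SL2R S
    by (subst null_sets_distr_iff[OF f]) (auto simp: null_sets_restrict_space space_restrict_space)
  then show ?thesis by (simp add: haar_SL2R_def S_def f_def[abs_def])
qed

text \<open>
  An exceptional null set of linear parts stays null when all translations are adjoined: its product
  with the plane has measure \<open>0 \<cdot> \<infinity> = 0\<close>.
\<close>
lemma almost_every_affine_latticeI: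
  assumes "\<And>A v. A \<notin> row_relations \<Longrightarrow> A \<in> SL2R \<Longrightarrow> P (affine_lattice A v)"
  shows "almost_every_affine_lattice P"
proof -
  have "sigma_finite_measure (lborel :: plane measure)" by (rule sigma_finite_lborel)
  then have "(row_relations \<union> - SL2R) \<times> UNIV \<in> null_sets haar_ASL2R"
    using exceptional_null_haar unfolding haar_ASL2R_def
    by (auto simp: null_sets_def sigma_finite_measure.emeasure_pair_measure_Times)
  then show ?thesis
    unfolding almost_every_affine_lattice_def
    by (rule AE_I') (use assms in auto)
qed

lemma countable_if_finite_bounded_parts:
  fixes S :: "real set"
  assumes "\<And>K. finite {u \<in> S. \<bar>u\<bar> \<le> K}"
  shows "countable S"
proof -
  have eq: "(\<Union>N :: nat. {u \<in> S. \<bar>u\<bar> \<le> N}) = S"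
    by (auto intro: real_arch_simple)
  have "countable (\<Union>N :: nat. {u \<in> S. \<bar>u\<bar> \<le> N})"
    by (rule countable_UN[OF countableI_type countable_finite[OF assms]])
  then show ?thesis unfolding eq .
qed

lemma short_row_combination:
  fixes p q :: real and m n :: int
  assumes "\<bar>p * m + q * n\<bar> \<le> 1" "p * m + q * n \<noteq> 0"
  obtains m' n' :: int where "0 < p * m' + q * n'" "p * m' + q * n' \<le> 1"
proof (cases "0 < p * m + q * n")
  case True
  then show ?thesis using that assms by auto
next
  case False
  then show ?thesis using that[of "- m" "- n"] assms by auto
qed

lemma horocycle_transversal_Omega: "horocycle_transversal Omega"
  unfolding horocycle_transversal_def
proof
  show "Omega \<subseteq> AX2" by (auto simp: Omega_def)
  show "almost_every_affine_lattice (\<lambda>L. hit_times Omega L \<noteq> {} \<and>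
      countable (hit_times Omega L) \<and> discrete (hit_times Omega L))"
  proof (rule almost_every_affine_latticeI)
    fix A v assume A: "A \<notin> row_relations" "A \<in> SL2R"
    then have L: "affine_lattice A v \<in> AX2" by (auto simp: AX2_def)
    obtain m n :: int where mn: "m \<noteq> 0 \<or> n \<noteq> 0" "\<bar>A $ 1 $ 1 * m + A $ 1 $ 2 * n\<bar> \<le> 1"
      using small_integer_combination by blast
    then have "A $ 1 $ 1 * m + A $ 1 $ 2 * n \<noteq> 0"
      using A(1) by (auto simp: row_relations_def)
    then obtain m' n' :: int where "0 < A $ 1 $ 1 * m' + A $ 1 $ 2 * n'"
        "A $ 1 $ 1 * m' + A $ 1 $ 2 * n' \<le> 1"
      using short_row_combination mn(2) by metis
    then obtain w where "w \<in> affine_lattice A v" "0 < w $ 1" "w $ 1 \<le> 1"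
      using strip_meets_half_plane[OF A(2), where e = 1] by (metis abs_1)
    then have "w $ 2 / w $ 1 \<in> hit_times Omega (affine_lattice A v)"
      by (auto simp: hit_times_Omega[OF L])
    then show "hit_times Omega (affine_lattice A v) \<noteq> {} \<and>
        countable (hit_times Omega (affine_lattice A v)) \<and>
        discrete (hit_times Omega (affine_lattice A v))"
      using discrete_if_finite_bounded_parts countable_if_finite_bounded_parts
        finite_hit_times_bounded[OF L] by blast
  qed
qed

section \<open>Normal forms of unimodular lattices\<close>

lemma coprime_complement:
  fixes m n :: int
  assumes "coprime m n"
  obtains p q where "m * q - p * n = 1"
proof -
  obtain u v where "u * m + v * n = 1"
    using assms bezout_int[of m n] by auto
  then show ?thesis using that[of u "- v"] by (simp add: algebra_simps)
qed

lemma primitive_direction: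
  fixes m n :: int
  assumes "m \<noteq> 0 \<or> n \<noteq> 0"
  obtains d m' n' :: int where "0 < d" "m = d * m'" "n = d * n'" "coprime m' n'"
proof -
  have "m = gcd m n * (m div gcd m n)" "n = gcd m n * (n div gcd m n)" by simp_all
  moreover have "coprime (m div gcd m n) (n div gcd m n)"
    using assms by (simp add: div_gcd_coprime)
  moreover have "0 < gcd m n" using assms by simp
  ultimately show ?thesis using that by blast
qed

text \<open>
  The slopes \<open>\<le> 0\<close> in the strip form a nonempty set, and below any bound on their size a finite one,
  so a largest slope \<open>- s\<close> exists. It is attained by a primitive vector \<open>(a, - s a)\<close>. Completing this
  vector to a basis of determinant 1 forces the ordinate \<open>1 / a - s b\<close> on the second basis vector.
\<close>
lemma shear_normal_form:
  assumes g: "g \<in> SL2R" and short: "\<exists>(m :: int) (n :: int).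
      0 < g $ 1 $ 1 * m + g $ 1 $ 2 * n \<and> g $ 1 $ 1 * m + g $ 1 $ 2 * n \<le> 1"
  obtains a b s where "0 < a" "a \<le> 1" "1 - a < b" "b \<le> 1" "0 \<le> s" "s < inverse (a * b)"
    "\<And>v. affine_lattice g v = affine_lattice (h_mat s ** p_mat a b) v"
proof -
  define L where "L = affine_lattice g 0"
  have L: "L \<in> AX2" using g by (auto simp: L_def AX2_def)
  define H where "H = {u \<in> hit_times Omega L. u \<le> 0}"
  note hit = hit_times_Omega[OF L]
  have det: "g $ 1 $ 1 * g $ 2 $ 2 - g $ 1 $ 2 * g $ 2 $ 1 = 1"
    using g by (simp add: SL2R_iff)
  obtain w where w: "w \<in> L" "0 < w $ 1" "w $ 1 \<le> 1" "w $ 2 < 0"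
  proof -
    obtain m n :: int where mn: "0 < g $ 1 $ 1 * m + g $ 1 $ 2 * n" "g $ 1 $ 1 * m + g $ 1 $ 2 * n \<le> 1"
      using short by blast
    show ?thesis
      using strip_meets_half_plane[OF g mn, where e = "- 1" and v = 0] that unfolding L_def by auto
  qed
  define K where "K = \<bar>w $ 2 / w $ 1\<bar>"
  have wH: "w $ 2 / w $ 1 \<in> {u \<in> H. \<bar>u\<bar> \<le> K}"
    using w by (auto simp: H_def hit K_def divide_nonpos_pos)
  have fin: "finite {u \<in> H. \<bar>u\<bar> \<le> K}"
    using finite_hit_times_bounded[OF L, of K] by (rule rev_finite_subset) (auto simp: H_def)
  define s where "s = - Max {u \<in> H. \<bar>u\<bar> \<le> K}"
  have "- s \<in> {u \<in> H. \<bar>u\<bar> \<le> K}"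
    using Max_in[OF fin] wH unfolding s_def by force
  then have sH: "- s \<in> H" and s0: "0 \<le> s" by (auto simp: H_def)
  have s_max: "u \<le> - s" if "u \<in> H" for u
  proof (cases "\<bar>u\<bar> \<le> K")
    case True
    then show ?thesis using Max_ge[OF fin] that by (simp add: s_def)
  next
    case False
    have "w $ 2 / w $ 1 \<le> - s" using Max_ge[OF fin wH] by (simp add: s_def)
    moreover have "u \<le> w $ 2 / w $ 1" using False that unfolding K_def H_def by (simp del: abs_divide)
    ultimately show ?thesis by linarith
  qed
  obtain m0 n0 :: int where mn0: "0 < g $ 1 $ 1 * m0 + g $ 1 $ 2 * n0" "g $ 1 $ 1 * m0 + g $ 1 $ 2 * n0 \<le> 1"
    "g $ 2 $ 1 * m0 + g $ 2 $ 2 * n0 = - s * (g $ 1 $ 1 * m0 + g $ 1 $ 2 * n0)"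
    using sH unfolding H_def hit mem_Collect_eq by (auto simp: L_def mem_affine_lattice)
  have "m0 \<noteq> 0 \<or> n0 \<noteq> 0" using mn0(1) by auto
  then obtain d m n :: int where d: "0 < d" "m0 = d * m" "n0 = d * n" "coprime m n"
    using primitive_direction by blast
  define a where "a = g $ 1 $ 1 * m + g $ 1 $ 2 * n"
  have da: "g $ 1 $ 1 * m0 + g $ 1 $ 2 * n0 = d * a"
    by (simp add: d a_def algebra_simps)
  have a0: "0 < a" using mn0(1) d(1) unfolding da by (simp add: zero_less_mult_iff)
  have "1 * a \<le> d * a" using d(1) a0 by (intro mult_right_mono) auto
  then have a1: "a \<le> 1" using mn0(2) unfolding da by simp
  have "d * (g $ 2 $ 1 * m + g $ 2 $ 2 * n) = d * (- s * a)"
    using mn0(3) unfolding da by (simp add: d algebra_simps)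
  then have a_slope: "g $ 2 $ 1 * m + g $ 2 $ 2 * n = - s * a"
    using d(1) by (subst (asm) mult_left_cancel) auto
  obtain p0 q0 where pq0: "m * q0 - p0 * n = 1" using coprime_complement[OF d(4)] by blast
  \<comment> \<open>Adding multiples of the first basis vector moves the second abscissa into \<open>(1 - a, 1]\<close>.\<close>
  obtain k :: int where k: "1 - a < (g $ 1 $ 1 * p0 + g $ 1 $ 2 * q0) + k * a"
    "(g $ 1 $ 1 * p0 + g $ 1 $ 2 * q0) + k * a \<le> 1"
    using exists_int_translate[OF a0] by blast
  define p where "p = p0 + k * m"
  define q where "q = q0 + k * n"
  have pq: "m * q - p * n = 1" using pq0 by (simp add: p_def q_def algebra_simps)
  define b where "b = g $ 1 $ 1 * p + g $ 1 $ 2 * q"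
  have b: "1 - a < b" "b \<le> 1" using k by (simp_all add: b_def a_def p_def q_def algebra_simps)
  define y where "y = g $ 2 $ 1 * p + g $ 2 $ 2 * q"
  have "a * y - b * (g $ 2 $ 1 * m + g $ 2 $ 2 * n)
      = (g $ 1 $ 1 * g $ 2 $ 2 - g $ 1 $ 2 * g $ 2 $ 1) * of_int (m * q - p * n)"
    unfolding a_def b_def y_def by (simp add: algebra_simps)
  then have "a * y + b * s * a = 1" using det pq a_slope by simp
  then have y: "y = inverse a - s * b" using a0 by (simp add: field_simps)
  have b0: "0 < b" using b a1 by simp
  have "vector [b, y] \<in> L"
    unfolding L_def mem_affine_lattice by (intro exI[of _ p] exI[of _ q]) (simp add: b_def y_def)
  then have "y / b \<in> hit_times Omega L"
    unfolding hit mem_Collect_eq using b b0 by (intro bexI[of _ "vector [b, y]"]) auto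
  moreover have "- s < y / b" using a0 b0 by (simp add: y field_simps)
  \<comment> \<open>A slope \<open>\<le> 0\<close> here would exceed the largest one, \<open>- s\<close>.\<close>
  ultimately have "0 < y / b" using s_max[of "y / b"] by (force simp: H_def)
  then have "s < inverse (a * b)"
    using a0 b0 by (simp add: y field_simps)
  moreover have "affine_lattice g v = affine_lattice (h_mat s ** p_mat a b) v" for v
  proof (rule affine_lattice_change_basis[OF pq, symmetric])
    fix i :: 2
    show "(h_mat s ** p_mat a b) $ i $ 1 = g $ i $ 1 * m + g $ i $ 2 * n"
      using a_slope exhaust_2[of i] by (auto simp: a_def)
    show "(h_mat s ** p_mat a b) $ i $ 2 = g $ i $ 1 * p + g $ i $ 2 * q"
      using y exhaust_2[of i] by (auto simp: b_def y_def)
  qed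
  ultimately show ?thesis using that a0 a1 b s0 by blast
qed

text \<open>
  A short integer combination of the abscissas must vanish, which gives a primitive vertical vector
  \<open>(0, a)\<close> with \<open>a > 0\<close> after a change of sign. A complementary basis vector has abscissa \<open>1 / a\<close>,
  which exceeds 1 by hypothesis, and its ordinate \<open>- s / a\<close> may be shifted by multiples of \<open>a\<close> into
  \<open>[- a, 0)\<close>; that is \<open>0 < s \<le> a\<^sup>2\<close>.
\<close>
lemma diagonal_normal_form:
  assumes g: "g \<in> SL2R" and no_short: "\<nexists>(m :: int) (n :: int).
      0 < g $ 1 $ 1 * m + g $ 1 $ 2 * n \<and> g $ 1 $ 1 * m + g $ 1 $ 2 * n \<le> 1"
  obtains a s where "0 < a" "a \<le> 1" "0 < s" "s \<le> a\<^sup>2"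
    "\<And>v. affine_lattice g v = affine_lattice (h_mat s ** g_mat (- ln a)) v"
proof -
  have det: "g $ 1 $ 1 * g $ 2 $ 2 - g $ 1 $ 2 * g $ 2 $ 1 = 1"
    using g by (simp add: SL2R_iff)
  obtain m0 n0 :: int where mn0: "m0 \<noteq> 0 \<or> n0 \<noteq> 0" "\<bar>g $ 1 $ 1 * m0 + g $ 1 $ 2 * n0\<bar> \<le> 1"
    using small_integer_combination by blast
  have vert0: "g $ 1 $ 1 * m0 + g $ 1 $ 2 * n0 = 0"
    using short_row_combination[OF mn0(2)] no_short by blast
  obtain d m1 n1 :: int where d: "0 < d" "m0 = d * m1" "n0 = d * n1" "coprime m1 n1"
    using primitive_direction[OF mn0(1)] by blast
  have "d * (g $ 1 $ 1 * m1 + g $ 1 $ 2 * n1) = 0"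
    using vert0 by (simp add: d algebra_simps)
  then have vert1: "g $ 1 $ 1 * m1 + g $ 1 $ 2 * n1 = 0" using d(1) by simp
  obtain p' q' where "m1 * q' - p' * n1 = 1"
    using coprime_complement[OF d(4)] by blast
  then obtain p1 q1 where pq1: "p1 * n1 - m1 * q1 = 1"
    using that[of "- p'" "- q'"] by simp
  define c1 where "c1 = g $ 1 $ 1 * p1 + g $ 1 $ 2 * q1"
  define a1 where "a1 = g $ 2 $ 1 * m1 + g $ 2 $ 2 * n1"
  have "c1 * a1 - (g $ 1 $ 1 * m1 + g $ 1 $ 2 * n1) * (g $ 2 $ 1 * p1 + g $ 2 $ 2 * q1)
      = (g $ 1 $ 1 * g $ 2 $ 2 - g $ 1 $ 2 * g $ 2 $ 1) * of_int (p1 * n1 - m1 * q1)"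
    unfolding a1_def c1_def by (simp add: algebra_simps)
  then have ca1: "c1 * a1 = 1" using det pq1 vert1 by simp
  obtain p0 q0 m n :: int where pq0: "p0 * n - m * q0 = 1"
    and vert: "g $ 1 $ 1 * m + g $ 1 $ 2 * n = 0" and a0: "0 < g $ 2 $ 1 * m + g $ 2 $ 2 * n"
    and ca: "(g $ 1 $ 1 * p0 + g $ 1 $ 2 * q0) * (g $ 2 $ 1 * m + g $ 2 $ 2 * n) = 1"
  proof (cases "0 < a1")
    case True
    then show ?thesis using that[OF pq1 vert1] ca1 by (simp add: a1_def c1_def)
  next
    case False
    then have "a1 < 0" using ca1 by (cases "a1 = 0") auto
    then show ?thesis
      using that[of "- p1" "- n1" "- m1" "- q1"] pq1 vert1 ca1
      by (simp add: a1_def c1_def algebra_simps)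
  qed
  define a where "a = g $ 2 $ 1 * m + g $ 2 $ 2 * n"
  have a_pos: "0 < a" using a0 by (simp add: a_def)
  have c: "g $ 1 $ 1 * p0 + g $ 1 $ 2 * q0 = inverse a"
    using ca inverse_unique[of a] unfolding a_def by (simp add: mult.commute)
  have "\<not> inverse a \<le> 1"
  proof
    assume "inverse a \<le> 1"
    then have "0 < g $ 1 $ 1 * p0 + g $ 1 $ 2 * q0 \<and> g $ 1 $ 1 * p0 + g $ 1 $ 2 * q0 \<le> 1"
      using a_pos c by simp
    then show False using no_short by blast
  qed
  then have a_le: "a \<le> 1" using a_pos by (simp add: inverse_le_1_iff)
  \<comment> \<open>The bounds put \<open>s / a - a\<close> into \<open>(- a, 0]\<close>.\<close>
  obtain k :: int where k: "0 - a < - (g $ 2 $ 1 * p0 + g $ 2 $ 2 * q0) - a + k * a"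
    "- (g $ 2 $ 1 * p0 + g $ 2 $ 2 * q0) - a + k * a \<le> 0"
    using exists_int_translate[OF a_pos] by blast
  define p where "p = p0 - k * m"
  define q where "q = q0 - k * n"
  define s where "s = - a * (g $ 2 $ 1 * p + g $ 2 $ 2 * q)"
  have z: "- (g $ 2 $ 1 * p + g $ 2 $ 2 * q) = - (g $ 2 $ 1 * p0 + g $ 2 $ 2 * q0) + k * a"
    by (simp add: p_def q_def a_def algebra_simps)
  have s_eq: "s = a * (- (g $ 2 $ 1 * p + g $ 2 $ 2 * q))"
    by (simp add: s_def algebra_simps)
  have "0 < s" unfolding s_eq z using k a_pos by (intro mult_pos_pos) auto
  moreover have "s \<le> a\<^sup>2"
    unfolding s_eq z power2_eq_square using k a_pos by (intro mult_left_mono) auto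
  moreover have "affine_lattice g v = affine_lattice (h_mat s ** g_mat (- ln a)) v" for v
  proof (rule affine_lattice_change_basis[symmetric])
    show "p * n - m * q = 1" using pq0 by (simp add: p_def q_def algebra_simps)
    fix i :: 2
    show "(h_mat s ** g_mat (- ln a)) $ i $ 2 = g $ i $ 1 * m + g $ i $ 2 * n"
      using vert exhaust_2[of i] a_pos by (auto simp: a_def)
    have "g $ 1 $ 1 * p + g $ 1 $ 2 * q = inverse a - k * (g $ 1 $ 1 * m + g $ 1 $ 2 * n)"
      unfolding c[symmetric] p_def q_def by (simp add: algebra_simps)
    moreover have "s * inverse a = - (g $ 2 $ 1 * p + g $ 2 $ 2 * q)"
      using a_pos by (simp add: s_def field_simps)
    ultimately show "(h_mat s ** g_mat (- ln a)) $ i $ 1 = g $ i $ 1 * p + g $ i $ 2 * q"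
      using vert exhaust_2[of i] a_pos by auto
  qed
  ultimately show ?thesis using that a_pos a_le by blast
qed

lemma p_mat_SL2R: "a \<noteq> 0 \<Longrightarrow> p_mat a b \<in> SL2R"
  by (simp add: SL2R_iff)

lemma g_mat_SL2R: "g_mat t \<in> SL2R"
  by (simp add: SL2R_iff g_mat_def exp_minus)

lemma affine_lattice_horizontal_in_Omega:
  assumes "g \<in> SL2R" "0 < \<alpha>" "\<alpha> \<le> 1"
  shows "affine_lattice g (vector [\<alpha>, 0]) \<in> Omega"
proof -
  have "vector [\<alpha>, 0] \<in> affine_lattice g (vector [\<alpha>, 0])"
    unfolding mem_affine_lattice by (intro exI[of _ 0]) simp
  then show ?thesis using assms by (auto simp: Omega_def AX2_def)
qed

lemma Omega_parametrization:
  "Omega = {point1 a b s \<alpha> | a b s \<alpha>. (a, b, s, \<alpha>) \<in> params1}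
         \<union> {point2 a s \<alpha> | a s \<alpha>. (a, s, \<alpha>) \<in> params2}"
proof (intro equalityI subsetI)
  fix L assume "L \<in> Omega"
  then obtain g v x where g: "g \<in> SL2R" and L: "L = affine_lattice g v"
    and x: "0 < x" "x \<le> 1" "vector [x, 0] \<in> L"
    by (auto simp: Omega_def AX2_def)
  have Lx: "L = affine_lattice g (vector [x, 0])"
    using affine_lattice_recentre x(3) unfolding L by blast
  show "L \<in> {point1 a b s \<alpha> | a b s \<alpha>. (a, b, s, \<alpha>) \<in> params1}
         \<union> {point2 a s \<alpha> | a s \<alpha>. (a, s, \<alpha>) \<in> params2}"
  proof (cases "\<exists>(m :: int) (n :: int).
      0 < g $ 1 $ 1 * m + g $ 1 $ 2 * n \<and> g $ 1 $ 1 * m + g $ 1 $ 2 * n \<le> 1")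
    case True
    then obtain a b s where "0 < a" "a \<le> 1" "1 - a < b" "b \<le> 1" "0 \<le> s" "s < inverse (a * b)"
      "L = point1 a b s x"
      unfolding Lx point1_def by (rule shear_normal_form[OF g]) auto
    then have "(a, b, s, x) \<in> params1" using x by (simp add: params1_def)
    then show ?thesis using \<open>L = point1 a b s x\<close> by blast
  next
    case False
    then obtain a s where "0 < a" "a \<le> 1" "0 < s" "s \<le> a\<^sup>2" "L = point2 a s x"
      unfolding Lx point2_def by (rule diagonal_normal_form[OF g]) auto
    then have "(a, s, x) \<in> params2" using x by (simp add: params2_def)
    then show ?thesis using \<open>L = point2 a s x\<close> by blast
  qed
next
  fix L assume "L \<in> {point1 a b s \<alpha> | a b s \<alpha>. (a, b, s, \<alpha>) \<in> params1}
         \<union> {point2 a s \<alpha> | a s \<alpha>. (a, s, \<alpha>) \<in> params2}"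
  then show "L \<in> Omega"
    by (auto simp: params1_def params2_def point1_def point2_def
        intro!: affine_lattice_horizontal_in_Omega h_mat_mult_SL2R p_mat_SL2R g_mat_SL2R)
qed

section \<open>Return times\<close>

lemma point1_AX2: "(a, b, s, \<alpha>) \<in> params1 \<Longrightarrow> point1 a b s \<alpha> \<in> AX2"
  by (auto simp: params1_def point1_def AX2_def intro!: h_mat_mult_SL2R p_mat_SL2R)

lemma return_times_point1:
  assumes "(a, b, s, \<alpha>) \<in> params1"
  shows "u \<in> return_times (point1 a b s \<alpha>) \<longleftrightarrow>
    (\<exists>(m :: int) (n :: int). 0 < a * m + b * n + \<alpha> \<and> a * m + b * n + \<alpha> \<le> 1
       \<and> 0 < (inverse a - s * b) * n - s * a * m
       \<and> u = ((inverse a - s * b) * n - s * a * m) / (a * m + b * n + \<alpha>))" (is "?l \<longleftrightarrow> ?r")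
proof
  assume ?l
  then obtain w where w: "w \<in> point1 a b s \<alpha>" "0 < w $ 1" "w $ 1 \<le> 1" "w $ 2 = u * w $ 1" "0 < u"
    by (auto simp: return_times_def hit_times_Omega[OF point1_AX2[OF assms]])
  then obtain m n :: int where mn: "w $ 1 = a * m + b * n + \<alpha>"
      "w $ 2 = (inverse a - s * b) * n - s * a * m"
    by (auto simp: point1_def mem_affine_lattice algebra_simps)
  have "0 < w $ 2" using w by simp
  moreover have "u = w $ 2 / w $ 1" using w by simp
  ultimately show ?r using w mn by metis
next
  assume ?r
  then obtain m n :: int where mn: "0 < a * m + b * n + \<alpha>" "a * m + b * n + \<alpha> \<le> 1"
    "0 < (inverse a - s * b) * n - s * a * m"
    "u = ((inverse a - s * b) * n - s * a * m) / (a * m + b * n + \<alpha>)" by blast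
  define w :: plane where "w = vector [a * m + b * n + \<alpha>, (inverse a - s * b) * n - s * a * m]"
  have "w \<in> point1 a b s \<alpha>"
    unfolding point1_def mem_affine_lattice
    by (intro exI[of _ m] exI[of _ n]) (simp add: w_def algebra_simps)
  moreover have "0 < w $ 1" "w $ 1 \<le> 1" "w $ 2 = u * w $ 1" "0 < u"
    using mn by (simp_all add: w_def)
  ultimately show ?l
    by (auto simp: return_times_def hit_times_Omega[OF point1_AX2[OF assms]])
qed

text \<open>
  Positive hitting times exist since the strip contains points in the upper half plane, and only
  finitely many of them lie below a given one.
\<close>
lemma return_times_have_minimum:
  assumes P: "(a, b, s, \<alpha>) \<in> params1"
  obtains u where "u \<in> return_times (point1 a b s \<alpha>)"
    "\<And>u'. u' \<in> return_times (point1 a b s \<alpha>) \<Longrightarrow> u \<le> u'"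
proof -
  define T where "T = return_times (point1 a b s \<alpha>)"
  have g: "h_mat s ** p_mat a b \<in> SL2R" and "0 < a" "a \<le> 1"
    using P by (auto simp: params1_def intro!: h_mat_mult_SL2R p_mat_SL2R)
  then obtain w where w: "w \<in> point1 a b s \<alpha>" "0 < w $ 1" "w $ 1 \<le> 1" "0 < w $ 2"
    unfolding point1_def
    using strip_meets_half_plane[OF g, where m = 1 and n = 0 and e = 1] by auto
  define K where "K = w $ 2 / w $ 1"
  define F where "F = {u \<in> T. \<bar>u\<bar> \<le> K}"
  have KF: "K \<in> F"
    using w by (auto simp: F_def T_def K_def return_times_def hit_times_Omega[OF point1_AX2[OF P]])
  have fin: "finite F"
    using finite_hit_times_bounded[OF point1_AX2[OF P], of K]
    by (rule rev_finite_subset) (auto simp: F_def T_def return_times_def)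
  have "F \<subseteq> T" by (auto simp: F_def)
  then have "Min F \<in> T" using Min_in[OF fin] KF by blast
  moreover have "Min F \<le> u'" if "u' \<in> T" for u'
  proof (cases "\<bar>u'\<bar> \<le> K")
    case True
    then show ?thesis using that fin by (simp add: F_def)
  next
    case False
    moreover have "0 < u'" using that by (simp add: T_def return_times_def)
    moreover have "Min F \<le> K" using fin KF by simp
    ultimately show ?thesis by linarith
  qed
  ultimately show ?thesis using that by (simp add: T_def)
qed

lemma return_time_minimal:
  assumes "(a, b, s, \<alpha>) \<in> params1"
  shows "return_time a b s \<alpha> \<in> return_times (point1 a b s \<alpha>)"
    and "u \<in> return_times (point1 a b s \<alpha>) \<Longrightarrow> return_time a b s \<alpha> \<le> u"
proof -
  obtain u0 where u0: "u0 \<in> return_times (point1 a b s \<alpha>)"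
    "\<And>u'. u' \<in> return_times (point1 a b s \<alpha>) \<Longrightarrow> u0 \<le> u'"
    using return_times_have_minimum[OF assms] by blast
  then have "return_time a b s \<alpha> = u0"
    unfolding return_time_def by (intro Least_equality) auto
  with u0 show "return_time a b s \<alpha> \<in> return_times (point1 a b s \<alpha>)"
    "u \<in> return_times (point1 a b s \<alpha>) \<Longrightarrow> return_time a b s \<alpha> \<le> u" by auto
qed

lemma return_time_eqI:
  assumes "(a, b, s, \<alpha>) \<in> params1" "u \<in> return_times (point1 a b s \<alpha>)"
    "\<And>u'. u' \<in> return_times (point1 a b s \<alpha>) \<Longrightarrow> u \<le> u'"
  shows "return_time a b s \<alpha> = u"
  using return_time_minimal[OF assms(1)] assms(2,3) by (meson order_antisym)

section \<open>Which lattice rows can contain the next visit\<close>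

locale section_point =
  fixes a b s \<alpha> :: real
  assumes params: "(a, b, s, \<alpha>) \<in> params1"
begin

lemma bounds:
  shows "0 < a" "a \<le> 1" "1 - a < b" "b \<le> 1" "0 \<le> s" "0 < \<alpha>" "\<alpha> \<le> 1" "0 < b"
    "0 < inverse a - s * b" "0 < 1 - s * a * b"
proof -
  show ab: "0 < a" "a \<le> 1" "1 - a < b" "b \<le> 1" "0 \<le> s" "0 < \<alpha>" "\<alpha> \<le> 1" "0 < b"
    using params by (auto simp: params1_def)
  have "s < inverse (a * b)" using params by (simp add: params1_def)
  then have "s * (a * b) < 1"
    using ab by (simp add: inverse_eq_divide pos_less_divide_eq)
  then show "0 < 1 - s * a * b" by (simp add: mult.assoc)
  then show "0 < inverse a - s * b" using ab by (simp add: field_simps)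
qed

definition visit :: "int \<Rightarrow> int \<Rightarrow> bool" where
  "visit m n \<longleftrightarrow> 0 < a * m + b * n + \<alpha> \<and> a * m + b * n + \<alpha> \<le> 1
     \<and> 0 < (inverse a - s * b) * n - s * a * m"

definition slope :: "int \<Rightarrow> int \<Rightarrow> real" where
  "slope m n = ((inverse a - s * b) * n - s * a * m) / (a * m + b * n + \<alpha>)"

lemma return_times_eq: "return_times (point1 a b s \<alpha>) = {slope m n | m n. visit m n}"
  using return_times_point1[OF params] unfolding visit_def slope_def by blast

lemma return_time_eq_slope:
  assumes "visit m n" "\<And>m' n'. visit m' n' \<Longrightarrow> slope m n \<le> slope m' n'"
  shows "return_time a b s \<alpha> = slope m n"
  using assms by (intro return_time_eqI[OF params]) (auto simp: return_times_eq)

text \<open>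
  For fixed \<open>m\<close> the abscissa determines \<open>n\<close>; eliminating \<open>n\<close> leaves a slope that depends on the abscissa
  only through one fraction, with a numerator that is constant on the row.
\<close>
lemma slope_eq:
  assumes "0 < a * m + b * n + \<alpha>"
  shows "slope m n = (inverse (a * b) - s)
    + (- a * m - \<alpha> * (1 - s * a * b)) / (a * b * (a * m + b * n + \<alpha>))"
proof -
  define x where "x = a * m + b * n + \<alpha>"
  have x: "x > 0" "b * n = x - a * m - \<alpha>" using assms by (simp_all add: x_def)
  have y: "((inverse a - s * b) * n - s * a * m) * (a * b)
     = (1 - s * a * b) * x + (- a * m - \<alpha> * (1 - s * a * b))"
  proof -
    have "a * inverse a = 1" using bounds(1) by simp
    then show ?thesis using x(2) by algebra
  qed
  have "slope m n = (((inverse a - s * b) * n - s * a * m) * (a * b)) / (a * b * x)"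
    unfolding slope_def x_def[symmetric] using bounds(1,8) by simp
  also have "\<dots> = (inverse (a * b) - s) + (- a * m - \<alpha> * (1 - s * a * b)) / (a * b * x)"
    unfolding y using bounds(1,8) x(1) by (simp add: field_simps)
  finally show ?thesis unfolding x_def .
qed

lemma slope_le_iff:
  assumes "0 < a * m + b * n + \<alpha>" "0 < a * m' + b * n' + \<alpha>"
  shows "slope m n \<le> slope m' n' \<longleftrightarrow>
    (- a * m - \<alpha> * (1 - s * a * b)) / (a * m + b * n + \<alpha>)
      \<le> (- a * m' - \<alpha> * (1 - s * a * b)) / (a * m' + b * n' + \<alpha>)"
proof -
  have "slope m n \<le> slope m' n' \<longleftrightarrow>
      (- a * m - \<alpha> * (1 - s * a * b)) / (a * m + b * n + \<alpha>) / (a * b)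
      \<le> (- a * m' - \<alpha> * (1 - s * a * b)) / (a * m' + b * n' + \<alpha>) / (a * b)"
    using slope_eq[OF assms(1)] slope_eq[OF assms(2)] by (simp add: mult.commute)
  moreover have "0 < a * b" using bounds(1,8) by simp
  ultimately show ?thesis by (simp only: divide_le_cancel) auto
qed

text \<open>
  For \<open>m \<ge> 0\<close> a positive ordinate needs \<open>n \<ge> 1\<close>. For \<open>m \<ge> 1\<close> the abscissa would be at least
  \<open>a + b + \<alpha>\<close>, and \<open>a + b > 1\<close>.
\<close>
lemma visit_nonneg_row:
  assumes "visit m n" "0 \<le> m"
  shows "m = 0" "1 \<le> n" "b + \<alpha> \<le> 1"
proof -
  have v: "a * m + b * n + \<alpha> \<le> 1" "0 < (inverse a - s * b) * n - s * a * m"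
    using assms(1) by (auto simp: visit_def)
  have am: "0 \<le> a * m" "0 \<le> s * a * m" using bounds assms(2) by auto
  have "0 < (inverse a - s * b) * n" using v(2) am by linarith
  then show n: "1 \<le> n" using bounds(9) by (simp add: zero_less_mult_iff)
  have bn: "b * 1 \<le> b * n" using n bounds by (intro mult_left_mono) auto
  show "m = 0"
  proof (rule ccontr)
    assume "m \<noteq> 0"
    then have "a * 1 \<le> a * m" using assms(2) bounds by (intro mult_left_mono) auto
    then show False using v(1) bn bounds by linarith
  qed
  then show "b + \<alpha> \<le> 1" using v(1) bn by simp
qed

text \<open>
  For \<open>m \<le> - 1\<close> and \<open>n \<le> - 1\<close> the abscissa is at most \<open>\<alpha> - a - b\<close>, which is negative as
  \<open>\<alpha> \<le> 1 < a + b\<close>.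
\<close>
lemma visit_neg_row:
  assumes "visit m n" "m < 0"
  obtains k where "1 \<le> k" "m = - int k" "0 \<le> n" "n \<le> row_index a b \<alpha> k"
proof -
  have v: "0 < a * m + b * n + \<alpha>" "a * m + b * n + \<alpha> \<le> 1"
    using assms(1) by (auto simp: visit_def)
  have am: "a * m \<le> a * (- 1)" using assms(2) bounds by (intro mult_left_mono) auto
  have "0 \<le> n"
  proof (rule ccontr)
    assume "\<not> 0 \<le> n"
    then have "b * n \<le> b * (- 1)" using bounds by (intro mult_left_mono) auto
    then show False using v am bounds by linarith
  qed
  moreover have "n \<le> row_index a b \<alpha> (nat (- m))"
    unfolding row_index_def le_floor_iff using v(2) bounds(8) assms(2)
    by (simp add: field_simps)
  ultimately show ?thesis using that[of "nat (- m)"] assms(2) by simp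
qed

text \<open>
  The abscissas of a row are spaced by \<open>b\<close>, so the largest one that is \<open>\<le> 1\<close> exceeds \<open>1 - b \<ge> 0\<close>.
\<close>
lemma row_abscissa_bounds: "0 < row_abscissa a b \<alpha> k" "row_abscissa a b \<alpha> k \<le> 1"
proof -
  define r where "r = real_of_int (row_index a b \<alpha> k)"
  have "r \<le> (1 + k * a - \<alpha>) / b" "(1 + k * a - \<alpha>) / b < r + 1"
    unfolding r_def row_index_def by linarith+
  then have "r * b \<le> 1 + k * a - \<alpha>" "1 + k * a - \<alpha> < (r + 1) * b"
    using bounds(8) by (simp_all add: pos_le_divide_eq pos_divide_less_eq)
  then show "0 < row_abscissa a b \<alpha> k" "row_abscissa a b \<alpha> k \<le> 1"
    unfolding row_abscissa_def r_def[symmetric] using bounds(4) by (auto simp: algebra_simps)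
qed

lemma row_abscissa_eq:
  "a * of_int (- int k) + b * row_index a b \<alpha> k + \<alpha> = row_abscissa a b \<alpha> k"
  by (simp add: row_abscissa_def mult.commute)

lemma row_slope_eq: "row_slope a b s \<alpha> k = slope (- int k) (row_index a b \<alpha> k)"
  unfolding slope_def row_abscissa_eq row_slope_def by (simp add: algebra_simps)

text \<open>
  The hypotheses shared by the two cases in which the return time is an infimum over rows. The last
  one guarantees that the best point of each row has positive ordinate: for \<open>s > 0\<close> because of the
  term \<open>k s a\<close>, and for \<open>\<alpha> \<le> a\<close> because then its second integer coordinate is at least 1.
\<close>
context
  assumes no_visit_nonneg: "\<And>m n. visit m n \<Longrightarrow> m < 0"
    and numerator_nonneg: "0 \<le> a - \<alpha> * (1 - s * a * b)"
    and first_rows_positive: "0 < s \<or> \<alpha> \<le> a"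
begin

lemma numerator_nonneg_row: "1 \<le> k \<Longrightarrow> 0 \<le> real k * a - \<alpha> * (1 - s * a * b)"
proof -
  assume "1 \<le> k"
  then have "1 * a \<le> real k * a" using bounds by (intro mult_right_mono) auto
  then show ?thesis using numerator_nonneg by simp
qed

lemma visit_row:
  assumes "1 \<le> k"
  shows "visit (- int k) (row_index a b \<alpha> k)"
proof -
  have ka: "1 * a \<le> real k * a" using assms bounds by (intro mult_right_mono) auto
  have r0: "0 \<le> row_index a b \<alpha> k"
  proof -
    have "0 \<le> (1 + real k * a - \<alpha>) / b"
      using bounds ka by (intro divide_nonneg_pos) linarith+
    then show ?thesis unfolding row_index_def by simp
  qed
  have "0 < (inverse a - s * b) * row_index a b \<alpha> k + s * a * k"
  proof (cases "0 < s")
    case True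
    then show ?thesis using bounds r0 assms by (intro add_nonneg_pos) auto
  next
    case False
    then have "b \<le> 1 + real k * a - \<alpha>"
      using first_rows_positive ka bounds by linarith
    then have "1 \<le> (1 + real k * a - \<alpha>) / b"
      using bounds by simp
    then have "1 \<le> row_index a b \<alpha> k" unfolding row_index_def by simp
    then show ?thesis using bounds by (intro add_pos_nonneg) auto
  qed
  then show ?thesis
    unfolding visit_def row_abscissa_eq using row_abscissa_bounds by simp
qed

text \<open>
  The numerator in the slope formula is nonnegative on row \<open>- k\<close>, so the slope decreases with the abscissa.
\<close>
lemma row_slope_least_in_row:
  assumes "1 \<le> k" "visit (- int k) n" "n \<le> row_index a b \<alpha> k"
  shows "row_slope a b s \<alpha> k \<le> slope (- int k) n"
proof -
  have v: "0 < a * of_int (- int k) + b * n + \<alpha>" using assms(2) by (simp add: visit_def)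
  have v': "0 < a * of_int (- int k) + b * row_index a b \<alpha> k + \<alpha>"
    using row_abscissa_bounds(1) unfolding row_abscissa_eq .
  have "b * n \<le> b * row_index a b \<alpha> k" using assms(3) bounds by (intro mult_left_mono) auto
  moreover have "0 \<le> - a * of_int (- int k) - \<alpha> * (1 - s * a * b)"
    using numerator_nonneg_row[OF assms(1)] by (simp add: mult.commute)
  ultimately show ?thesis
    unfolding row_slope_eq slope_le_iff[OF v' v]
    using mult_pos_pos[OF v' v] by (intro divide_left_mono) auto
qed

lemma row_slope_le_slope:
  assumes "visit m n"
  obtains k where "1 \<le> k" "row_slope a b s \<alpha> k \<le> slope m n"
  using visit_neg_row[OF assms no_visit_nonneg[OF assms]] row_slope_least_in_row assms by metis

lemma return_time_eq_INF: "return_time a b s \<alpha> = (INF k\<in>{1..}. row_slope a b s \<alpha> k)"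
proof -
  have le: "return_time a b s \<alpha> \<le> row_slope a b s \<alpha> k" if "k \<in> {1..}" for k
    using return_time_minimal(2)[OF params] visit_row[of k] that
    by (auto simp: return_times_eq row_slope_eq)
  obtain m n where "visit m n" "return_time a b s \<alpha> = slope m n"
    using return_time_minimal(1)[OF params] by (auto simp: return_times_eq)
  then obtain k where k: "k \<in> {1..}" "row_slope a b s \<alpha> k \<le> return_time a b s \<alpha>"
    using row_slope_le_slope by (metis atLeast_iff)
  then have "return_time a b s \<alpha> \<in> row_slope a b s \<alpha> ` {1..}"
    using le[OF k(1)] by (intro image_eqI[of _ _ k]) auto
  then show ?thesis using le by (intro cInf_eq_minimum[symmetric]) auto
qed

text \<open>
  With \<open>D = \<alpha> (1 - s a b) > 0\<close>, dominance replaces the abscissa of row \<open>k\<close> by \<open>k\<close> times that of the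
  first row; then \<open>(k a - D) / k = a - D / k \<ge> a - D\<close>.
\<close>
lemma return_time_first_row:
  assumes "first_row_dominant a b \<alpha>"
  shows "return_time a b s \<alpha> = row_slope a b s \<alpha> 1"
proof -
  define D where "D = \<alpha> * (1 - s * a * b)"
  have D: "0 < D" unfolding D_def using bounds by simp
  have first: "row_slope a b s \<alpha> 1 \<le> row_slope a b s \<alpha> k" if k: "1 \<le> k" for k
  proof -
    define x1 where "x1 = row_abscissa a b \<alpha> 1"
    define x where "x = row_abscissa a b \<alpha> k"
    have pos: "0 < x1" "0 < x" unfolding x1_def x_def by (rule row_abscissa_bounds)+
    have "x \<le> k * x1"
      using assms k pos by (cases "k = 1") (auto simp: first_row_dominant_def x_def x1_def)
    have "(a - D) / x1 \<le> (a - D / k) / x1"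
      using k D pos by (intro divide_right_mono diff_left_mono) (auto simp: divide_le_eq)
    also have "\<dots> = (k * a - D) / (k * x1)"
      using k pos by (simp add: field_simps)
    also have "\<dots> \<le> (k * a - D) / x"
      using \<open>x \<le> k * x1\<close> numerator_nonneg_row[OF k] pos k
      by (intro divide_left_mono) (auto simp: D_def)
    finally have "(a - D) / x1 \<le> (k * a - D) / x" .
    moreover have "0 < a * of_int (- int k) + b * row_index a b \<alpha> k + \<alpha>" for k
      using row_abscissa_bounds(1) unfolding row_abscissa_eq .
    ultimately show ?thesis
      unfolding row_slope_eq
      by (subst slope_le_iff, blast, blast, unfold row_abscissa_eq)
        (simp add: D_def x_def x1_def mult.commute)
  qed
  have "return_time a b s \<alpha> = slope (- int 1) (row_index a b \<alpha> 1)"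
  proof (rule return_time_eq_slope)
    show "visit (- int 1) (row_index a b \<alpha> 1)" by (rule visit_row) simp
    fix m n assume "visit m n"
    then obtain k where "1 \<le> k" "row_slope a b s \<alpha> k \<le> slope m n"
      by (rule row_slope_le_slope)
    then show "slope (- int 1) (row_index a b \<alpha> 1) \<le> slope m n"
      using first[of k] unfolding row_slope_eq by linarith
  qed
  then show ?thesis by (simp only: row_slope_eq)
qed

end

lemma row_slope_one: "row_slope a b s \<alpha> 1 =
    (of_int \<lfloor>(1 + a - \<alpha>) / b\<rfloor> * (inverse a - s * b) + s * a)
      / (\<alpha> - a + of_int \<lfloor>(1 + a - \<alpha>) / b\<rfloor> * b)"
  by (simp add: row_slope_def row_abscissa_def row_index_def)

lemma far_start_visit:
  assumes "\<alpha> > a" "visit m n"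
  shows "m < 0"
  using visit_nonneg_row[OF assms(2)] assms(1) bounds by force

text \<open>
  The point \<open>(-1, 0)\<close> wins. Comparing the slope of \<open>(-k, n)\<close> with it by cross multiplication leaves
  \<open>s a \<alpha> (k - 1) + n (\<alpha> (1 - s a b) - a) / a\<close>, and the bound on \<open>s\<close> makes the coefficient of \<open>n\<close> positive.
\<close>
lemma return_time_far_start_small_slope:
  assumes far: "\<alpha> > a" and s: "0 < s" "s < (\<alpha> - a) / (a * b * \<alpha>)"
  shows "return_time a b s \<alpha> = s * a / (\<alpha> - a)"
proof -
  have neg: "a - \<alpha> * (1 - s * a * b) < 0"
    using s(2) bounds by (simp add: field_simps)
  have "return_time a b s \<alpha> = slope (- 1) 0"
  proof (rule return_time_eq_slope)
    show "visit (- 1) 0"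
      using far s bounds by (simp add: visit_def)
    fix m n assume v: "visit m n"
    obtain k where k: "1 \<le> k" "m = - int k" "0 \<le> n"
      using visit_neg_row[OF v far_start_visit[OF far v]] by metis
    have x: "0 < a * m + b * n + \<alpha>" using v by (simp add: visit_def)
    have "s * a * (a * m + b * n + \<alpha>) \<le> ((inverse a - s * b) * n - s * a * m) * (\<alpha> - a)"
    proof -
      have "((inverse a - s * b) * n - s * a * m) * (\<alpha> - a) - s * a * (a * m + b * n + \<alpha>)
          = s * a * \<alpha> * (real k - 1) + n * ((\<alpha> * (1 - s * a * b) - a) / a)"
        using k(2) bounds(1) by (simp add: field_simps)
      moreover have "0 \<le> s * a * \<alpha> * (real k - 1)" using s bounds k(1) by auto
      moreover have "0 \<le> n * ((\<alpha> * (1 - s * a * b) - a) / a)"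
        using k(3) neg bounds by (intro mult_nonneg_nonneg divide_nonneg_pos) auto
      ultimately show ?thesis by linarith
    qed
    then show "slope (- 1) 0 \<le> slope m n"
      unfolding slope_def using far x by (simp add: frac_le_eq divide_le_eq pos_le_divide_eq mult.commute)
  qed
  then show ?thesis by (simp add: slope_def)
qed

lemma far_start_numerator_nonneg:
  assumes "\<alpha> > a" "s > (\<alpha> - a) / (a * b * \<alpha>)"
  shows "0 \<le> a - \<alpha> * (1 - s * a * b)" "0 < s"
proof -
  show "0 \<le> a - \<alpha> * (1 - s * a * b)" using assms bounds by (simp add: field_simps)
  have "0 < (\<alpha> - a) / (a * b * \<alpha>)" using assms(1) bounds by simp
  then show "0 < s" using assms(2) by linarith
qed

text \<open>
  The point \<open>(0, 1)\<close> wins. The numerator of the slope formula is negative on the row \<open>m = 0\<close>, so the smallest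
  abscissa \<open>b + \<alpha>\<close> is the best one there, while it is nonnegative on the rows with \<open>m < 0\<close>.
\<close>
lemma return_time_near_start_row_zero:
  assumes near: "\<alpha> \<le> a" and fits: "b + \<alpha> < 1"
  shows "return_time a b s \<alpha> = (inverse a - s * b) / (b + \<alpha>)"
proof -
  define D where "D = \<alpha> * (1 - s * a * b)"
  have D: "0 < D" "D \<le> \<alpha>" unfolding D_def using bounds by (auto simp: mult_le_cancel_left1)
  have "return_time a b s \<alpha> = slope 0 1"
  proof (rule return_time_eq_slope)
    show "visit 0 1" using bounds fits by (simp add: visit_def)
    have x0: "0 < a * of_int 0 + b * of_int 1 + \<alpha>" using bounds by simp
    fix m n assume v: "visit m n"
    then have x: "0 < a * m + b * n + \<alpha>" by (simp add: visit_def)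
    have "- D / (b + \<alpha>) \<le> (- a * m - D) / (a * m + b * n + \<alpha>)"
    proof (cases "0 \<le> m")
      case True
      then have mn: "m = 0" "1 \<le> n" using visit_nonneg_row[OF v] by auto
      then have "b * 1 \<le> b * n" using bounds by (intro mult_left_mono) auto
      then have "D / (b * n + \<alpha>) \<le> D / (b + \<alpha>)"
        using D bounds by (intro divide_left_mono mult_pos_pos) linarith+
      then show ?thesis using mn by simp
    next
      case False
      then have "a * m \<le> a * (- 1)" using bounds by (intro mult_left_mono) auto
      then have "0 \<le> (- a * m - D) / (a * m + b * n + \<alpha>)"
        using x near D by (intro divide_nonneg_pos) auto
      moreover have "- D / (b + \<alpha>) \<le> 0" using D bounds by (simp add: field_simps)
      ultimately show ?thesis by linarith
    qed
    then show "slope 0 1 \<le> slope m n"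
      unfolding slope_le_iff[OF x0 x] by (simp add: D_def)
  qed
  then show ?thesis by (simp add: slope_def)
qed

lemma near_start_visit:
  assumes "b + \<alpha> > 1" "visit m n"
  shows "m < 0"
  using visit_nonneg_row(3)[OF assms(2)] assms(1) by force

lemma near_start_numerator_nonneg:
  assumes "\<alpha> \<le> a"
  shows "0 \<le> a - \<alpha> * (1 - s * a * b)"
proof -
  have "0 \<le> \<alpha> * (s * a * b)" using bounds by simp
  then show ?thesis using assms by (simp add: algebra_simps)
qed

end

section \<open>The transversal, its parametrization and its return times\<close>

theorem theorem1p3:
  shows "horocycle_transversal Omega
    \<and> Omega = {point1 a b s \<alpha> | a b s \<alpha>. (a, b, s, \<alpha>) \<in> params1}
            \<union> {point2 a s \<alpha> | a s \<alpha>. (a, s, \<alpha>) \<in> params2}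
    \<and> (\<forall>(a, b, s, \<alpha>) \<in> params1.
         let j = real_of_int \<lfloor>(1 + a - \<alpha>) / b\<rfloor>;
             R = return_time a b s \<alpha>
         in
           R \<in> return_times (point1 a b s \<alpha>)
         \<and> (\<forall>u \<in> return_times (point1 a b s \<alpha>). R \<le> u)
         \<and> (\<alpha> > a \<longrightarrow>
              (0 < s \<and> s < (\<alpha> - a) / (a * b * \<alpha>) \<longrightarrow> R = s * a / (\<alpha> - a))
            \<and> (s > (\<alpha> - a) / (a * b * \<alpha>) \<longrightarrow>
                 R = (INF k\<in>{1..}. row_slope a b s \<alpha> k)
               \<and> (first_row_dominant a b \<alpha> \<longrightarrow>
                    R = (j * (inverse a - s * b) + s * a) / (\<alpha> - a + j * b))))
         \<and> (\<alpha> \<le> a \<longrightarrow>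
              (b + \<alpha> < 1 \<longrightarrow> R = (inverse a - s * b) / (b + \<alpha>))
            \<and> (b + \<alpha> > 1 \<longrightarrow>
                 R = (INF k\<in>{1..}. row_slope a b s \<alpha> k)
               \<and> (first_row_dominant a b \<alpha> \<longrightarrow>
                    R = (j * (inverse a - s * b) + s * a) / (\<alpha> - a + j * b)))))"
proof (intro conjI ballI horocycle_transversal_Omega Omega_parametrization, clarify)
  fix a b s \<alpha>
  assume P: "(a, b, s, \<alpha>) \<in> params1"
  then interpret section_point a b s \<alpha> by unfold_locales
  have far: "return_time a b s \<alpha> = (INF k\<in>{1..}. row_slope a b s \<alpha> k)"
      "first_row_dominant a b \<alpha> \<Longrightarrow> return_time a b s \<alpha> = row_slope a b s \<alpha> 1"
    if "\<alpha> > a" "s > (\<alpha> - a) / (a * b * \<alpha>)"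
    using return_time_eq_INF return_time_first_row far_start_visit far_start_numerator_nonneg that
    by blast+
  have near: "return_time a b s \<alpha> = (INF k\<in>{1..}. row_slope a b s \<alpha> k)"
      "first_row_dominant a b \<alpha> \<Longrightarrow> return_time a b s \<alpha> = row_slope a b s \<alpha> 1"
    if "\<alpha> \<le> a" "b + \<alpha> > 1"
    using return_time_eq_INF return_time_first_row near_start_visit near_start_numerator_nonneg that
    by blast+
  show "let j = real_of_int \<lfloor>(1 + a - \<alpha>) / b\<rfloor>;
             R = return_time a b s \<alpha>
         in
           R \<in> return_times (point1 a b s \<alpha>)
         \<and> (\<forall>u \<in> return_times (point1 a b s \<alpha>). R \<le> u)
         \<and> (\<alpha> > a \<longrightarrow>
              (0 < s \<and> s < (\<alpha> - a) / (a * b * \<alpha>) \<longrightarrow> R = s * a / (\<alpha> - a))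
            \<and> (s > (\<alpha> - a) / (a * b * \<alpha>) \<longrightarrow>
                 R = (INF k\<in>{1..}. row_slope a b s \<alpha> k)
               \<and> (first_row_dominant a b \<alpha> \<longrightarrow>
                    R = (j * (inverse a - s * b) + s * a) / (\<alpha> - a + j * b))))
         \<and> (\<alpha> \<le> a \<longrightarrow>
              (b + \<alpha> < 1 \<longrightarrow> R = (inverse a - s * b) / (b + \<alpha>))
            \<and> (b + \<alpha> > 1 \<longrightarrow>
                 R = (INF k\<in>{1..}. row_slope a b s \<alpha> k)
               \<and> (first_row_dominant a b \<alpha> \<longrightarrow>
                    R = (j * (inverse a - s * b) + s * a) / (\<alpha> - a + j * b))))"
    unfolding Let_def row_slope_one[symmetric]
    using return_time_minimal[OF P] return_time_far_start_small_slope far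
      return_time_near_start_row_zero near by blast
qed

end
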